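(* Let $A=[A_{ij}]_{i,j=1}^k$ be a Hermitian matrix partitioned into $k^2$ blocks, where the diagonal blocks $A_{ii}$ ($1\le i\le k$) are square matrices. For any real number $p\ge 1$, the following hold: \[ \mathcal{E}_p^+(A)\ge \sum_{i=1}^{k}\mathcal{E}_p^+(A_{ii}), \qquad \mathcal{E}_p^-(A)\ge \sum_{i=1}^{k}\mathcal{E}_p^-(A_{ii}).\]
   Context: For a Hermitian (complex) matrix $M$ of order $m$ with real eigenvalues $\lambda_1(M)\ge\cdots\ge\lambda_m(M)$ counted with multiplicity, and a real number $p\ge 1$, the positive and negative $p$-energies of $M$ are \[\mathcal{E}_p^+(M)=\sum_{i:\,\lambda_i(M)>0}\lambda_i(M)^p,\qquad \mathcal{E}_p^-(M)=\sum_{i:\,\lambda_i(M)<0}|\lambda_i(M)|^p .\] *)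

theory Defs
  imports
    Complex_Main
    "HOL-Computational_Algebra.Fundamental_Theorem_Algebra"
    "Jordan_Normal_Form.Schur_Decomposition"
    "Jordan_Normal_Form.DL_Submatrix"
begin

definition hermitian_mat :: "complex mat \<Rightarrow> bool" where
  "hermitian_mat A \<longleftrightarrow> mat_adjoint A = A"

lemma hermitian_mat_square:
  assumes "hermitian_mat A"
  shows "dim_row A = dim_col A"
proof -
  have "dim_row (mat_adjoint A) = dim_col A"
    by (simp add: mat_adjoint_def)
  thus ?thesis
    using assms by (simp add: hermitian_mat_def)
qed

lemma hermitian_mat_index:
  assumes "hermitian_mat A" "i < dim_row A" "j < dim_row A"
  shows "A $$ (i, j) = cnj (A $$ (j, i))"
proof -
  have "A $$ (i, j) = mat_adjoint A $$ (i, j)"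
    using assms by (simp add: hermitian_mat_def)
  also have "\<dots> = cnj (A $$ (j, i))"
    using assms hermitian_mat_square[OF assms(1)]
    by (simp add: mat_adjoint_def mat_of_rows_index)
  finally show ?thesis .
qed

(* The eigenvalues with multiplicity are the roots of the characteristic polynomial.
   For Hermitian M they are real (hermitian_mat_eigenvalue_real), so that Re loses nothing. *)
definition real_eigenvalues :: "complex mat \<Rightarrow> real multiset" where
  "real_eigenvalues M = image_mset Re (proots (char_poly M))"

definition pos_energy :: "real \<Rightarrow> complex mat \<Rightarrow> real" where
  "pos_energy p M = (\<Sum>x \<in># filter_mset (\<lambda>x. x > 0) (real_eigenvalues M). x powr p)"

definition neg_energy :: "real \<Rightarrow> complex mat \<Rightarrow> real" where
  "neg_energy p M = (\<Sum>x \<in># filter_mset (\<lambda>x. x < 0) (real_eigenvalues M). \<bar>x\<bar> powr p)"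

lemma size_real_eigenvalues:
  assumes "M \<in> carrier_mat m m"
  shows "size (real_eigenvalues M) = m"
  using degree_monic_char_poly[OF assms]
  by (simp add: real_eigenvalues_def size_proots_complex)

lemma hermitian_mat_eigenvalue_real:
  assumes "hermitian_mat M" "x \<in># proots (char_poly M)"
  shows "x \<in> \<real>"
proof -
  define m where "m = dim_row M"
  have M: "M \<in> carrier_mat m m"
    using hermitian_mat_square[OF assms(1)] by (auto simp: m_def)
  have "char_poly M \<noteq> 0"
    using degree_monic_char_poly[OF M] by auto
  hence "eigenvalue M x"
    using assms(2) by (simp add: eigenvalue_root_char_poly[OF M])
  then obtain v where v: "v \<in> carrier_vec m" "v \<noteq> 0\<^sub>v m" and Mv: "M *\<^sub>v v = x \<cdot>\<^sub>v v"
    unfolding eigenvalue_def eigenvector_def m_def by auto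
  define q where "q = (M *\<^sub>v v) \<bullet>c v"
  have q: "q = (\<Sum>i<m. \<Sum>j<m. cnj (v $ i) * M $$ (i, j) * v $ j)"
  proof -
    have Mv_index: "(M *\<^sub>v v) $ i = (\<Sum>j<m. M $$ (i, j) * v $ j)" if "i < m" for i
      using that v(1) M by (simp add: scalar_prod_def lessThan_atLeast0)
    have "q = (\<Sum>i<m. (M *\<^sub>v v) $ i * cnj (v $ i))"
      using v(1) by (simp add: q_def scalar_prod_def lessThan_atLeast0)
    also have "\<dots> = (\<Sum>i<m. cnj (v $ i) * (\<Sum>j<m. M $$ (i, j) * v $ j))"
      by (intro sum.cong refl) (simp only: lessThan_iff Mv_index mult.commute)
    finally show ?thesis
      by (simp only: sum_distrib_left mult.assoc)
  qed
  have "cnj q = (\<Sum>i<m. \<Sum>j<m. cnj (v $ j) * M $$ (j, i) * v $ i)"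
  proof -
    have "cnj (cnj (v $ i) * M $$ (i, j) * v $ j) = cnj (v $ j) * M $$ (j, i) * v $ i"
      if "i < m" "j < m" for i j
      using hermitian_mat_index[OF assms(1), of j i] that by (simp add: m_def)
    thus ?thesis
      unfolding q cnj_sum by (intro sum.cong) auto
  qed
  also have "\<dots> = q"
    unfolding q by (rule sum.swap)
  finally have qr: "cnj q = q" .
  have "q = x * (v \<bullet>c v)"
    unfolding q_def Mv using v by simp
  moreover have "cnj (v \<bullet>c v) = v \<bullet>c v"
    using conjugate_vec_sprod_comm[of v m v] conjugate_conjugate_sprod[of v m v] v(1) by simp
  moreover have "v \<bullet>c v \<noteq> 0"
    using v by simp
  ultimately have "cnj x = x"
    using qr by simp
  thus ?thesis
    by (simp add: Reals_cnj_iff)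
qed

(* The (i, j) block, counted from 0, of a matrix whose rows and columns are both cut into
   consecutive groups of sizes n 0, n 1, ... *)
definition block_of :: "(nat \<Rightarrow> nat) \<Rightarrow> 'a mat \<Rightarrow> nat \<Rightarrow> nat \<Rightarrow> 'a mat" where
  "block_of n A i j =
     submatrix A {(\<Sum>l<i. n l)..<(\<Sum>l<Suc i. n l)} {(\<Sum>l<j. n l)..<(\<Sum>l<Suc j. n l)}"

lemma pick_atLeastLessThan:
  assumes "r < b - a"
  shows "pick {a..<b} r = a + r"
proof -
  have "{x \<in> {a..<b}. x < a + r} = {a..<a + r}"
    using assms by auto
  thus ?thesis
    using pick_card_in_set[of "a + r" "{a..<b}"] assms by simp
qed

lemma card_block_interval:
  fixes n :: "nat \<Rightarrow> nat"
  assumes "i < k"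
  shows "card {r. r < (\<Sum>l<k. n l) \<and> (\<Sum>l<i. n l) \<le> r \<and> r < (\<Sum>l<i. n l) + n i} = n i"
proof -
  have "(\<Sum>l<Suc i. n l) \<le> (\<Sum>l<k. n l)"
    using assms by (intro sum_mono2) auto
  hence "{r. r < (\<Sum>l<k. n l) \<and> (\<Sum>l<i. n l) \<le> r \<and> r < (\<Sum>l<i. n l) + n i}
      = {(\<Sum>l<i. n l)..<(\<Sum>l<i. n l) + n i}"
    by auto
  thus ?thesis
    by simp
qed

lemma block_of_carrier:
  assumes "A \<in> carrier_mat (\<Sum>l<k. n l) (\<Sum>l<k. n l)" "i < k" "j < k"
  shows "block_of n A i j \<in> carrier_mat (n i) (n j)"
proof -
  have "dim_row A = (\<Sum>l<k. n l)" "dim_col A = (\<Sum>l<k. n l)"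
    using assms(1) by auto
  thus ?thesis
    using card_block_interval[OF assms(2)] card_block_interval[OF assms(3)]
    by (intro carrier_matI) (simp_all add: block_of_def dim_submatrix)
qed

lemma block_of_index:
  assumes "A \<in> carrier_mat (\<Sum>l<k. n l) (\<Sum>l<k. n l)" "i < k" "j < k" "r < n i" "c < n j"
  shows "block_of n A i j $$ (r, c) = A $$ ((\<Sum>l<i. n l) + r, (\<Sum>l<j. n l) + c)"
proof -
  have "r < dim_row (block_of n A i j)" "c < dim_col (block_of n A i j)"
    using block_of_carrier[OF assms(1-3)] assms(4,5) by auto
  thus ?thesis
    unfolding block_of_def dim_submatrix
    using assms(4,5) by (subst submatrix_index) (simp_all add: pick_atLeastLessThan)
qed

end

theory Submission
  imports Defs "HOL-Analysis.Convex"
begin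

text \<open>
  Both energies have the form $\sum_x f(x)$, where $x$ runs through the eigenvalues with
  multiplicity and $f$ is convex on the whole real line: $f(x) = \max(x,0)^p$ for the positive
  energy and $f(x) = \max(-x,0)^p$ for the negative one. So it suffices to show that, for convex
  $f$, passing from a Hermitian matrix to its diagonal blocks does not increase the sum of $f$ over
  the eigenvalues (\<open>sum_eigenvalues_diagonal_blocks_le\<close>).

  This follows from Peierls' inequality, used in matrix form. Diagonalize $A = W D W^*$ and every
  diagonal block $A_{ii} = U_i D_i U_i^*$, and let $T$ be the block diagonal unitary matrix with
  blocks $U_i$. Then $T^* A T = X^* D X$ with the unitary matrix $X = W^* T$, and the diagonal of
  $T^* A T$ lists exactly the eigenvalues of all the blocks. On the other hand, its $j$-th entry is
  $\sum_i |X_{ij}|^2 d_i$, an average of the eigenvalues $d_i$ of $A$ with weights from the doubly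
  stochastic matrix $(|X_{ij}|^2)$. Jensen's inequality for each $j$, using the column sums,
  followed by summation over $j$, using the row sums, gives the claim
  (\<open>sum_diagonal_le_of_convex\<close>). Two blocks are enough, because the last block can be
  split off repeatedly.

  The spectral theorem that this needs, \<open>hermitian_mat_diagonalization\<close>, is proved by the
  usual induction on the order: an eigenvector is completed to an orthonormal basis, and symmetry
  makes the first row as well as the first column of the transformed matrix vanish off the diagonal.
\<close>

section \<open>Adjoints and unitary matrices\<close>

lemma dim_mat_adjoint [simp]:
  "dim_row (mat_adjoint A) = dim_col A" "dim_col (mat_adjoint A) = dim_row A"
  by (simp_all add: mat_adjoint_def)

lemma mat_adjoint_carrier [simp, intro]:
  "A \<in> carrier_mat n m \<Longrightarrow> mat_adjoint A \<in> carrier_mat m n"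
  by auto

lemma mat_adjoint_index [simp]:
  fixes A :: "complex mat"
  assumes "i < dim_col A" "j < dim_row A"
  shows "mat_adjoint A $$ (i, j) = cnj (A $$ (j, i))"
  using assms by (simp add: mat_adjoint_def mat_of_rows_index)

lemma mat_adjoint_adjoint [simp]:
  fixes A :: "complex mat"
  shows "mat_adjoint (mat_adjoint A) = A"
  by (rule eq_matI) auto

lemma mat_adjoint_zero [simp]: "mat_adjoint (0\<^sub>m n m :: complex mat) = 0\<^sub>m m n"
  by (rule eq_matI) auto

lemma mat_adjoint_one [simp]: "mat_adjoint (1\<^sub>m n :: complex mat) = 1\<^sub>m n"
  by (rule eq_matI) auto

lemma mat_adjoint_mult:
  fixes A B :: "complex mat"
  assumes "A \<in> carrier_mat n m" "B \<in> carrier_mat m l"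
  shows "mat_adjoint (A * B) = mat_adjoint B * mat_adjoint A"
  using assms by (intro eq_matI) (auto simp: scalar_prod_def mult.commute)

lemma mat_adjoint_four_block_mat:
  fixes A B C D :: "complex mat"
  assumes "A \<in> carrier_mat n1 m1" "B \<in> carrier_mat n1 m2"
    and "C \<in> carrier_mat n2 m1" "D \<in> carrier_mat n2 m2"
  shows "mat_adjoint (four_block_mat A B C D) =
    four_block_mat (mat_adjoint A) (mat_adjoint C) (mat_adjoint B) (mat_adjoint D)"
  using assms by (intro eq_matI) auto

lemma hermitian_mat_congruence:
  assumes "A \<in> carrier_mat n n" "hermitian_mat A" "U \<in> carrier_mat n m"
  shows "hermitian_mat (mat_adjoint U * A * U)"
proof -
  have "mat_adjoint (mat_adjoint U * A * U) = mat_adjoint U * (mat_adjoint A * U)"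
    using assms
    by (simp add: mat_adjoint_mult[of _ m n _ m] mat_adjoint_mult[of _ m n _ n]
        mult_carrier_mat[of _ m n _ n])
  also have "\<dots> = mat_adjoint U * A * U"
    using assms by (simp add: hermitian_mat_def assoc_mult_mat[of _ m n _ n _ m])
  finally show ?thesis
    by (simp add: hermitian_mat_def)
qed

lemma hermitian_four_block_matD:
  assumes "hermitian_mat (four_block_mat B C E D)"
    and "B \<in> carrier_mat n n" "C \<in> carrier_mat n m" "E \<in> carrier_mat m n" "D \<in> carrier_mat m m"
  shows "hermitian_mat B" "hermitian_mat D" "C = mat_adjoint E"
proof -
  let ?A = "four_block_mat B C E D"
  note idx = hermitian_mat_index[OF assms(1)]
  have "cnj (B $$ (j, i)) = B $$ (i, j)" if "i < n" "j < n" for i j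
    using idx[of i j] that assms(2-5) by auto
  then show "hermitian_mat B"
    unfolding hermitian_mat_def using assms(2) by (intro eq_matI) auto
  have "cnj (D $$ (j, i)) = D $$ (i, j)" if "i < m" "j < m" for i j
    using idx[of "n + i" "n + j"] that assms(2-5) by auto
  then show "hermitian_mat D"
    unfolding hermitian_mat_def using assms(5) by (intro eq_matI) auto
  have "C $$ (i, j) = cnj (E $$ (j, i))" if "i < n" "j < m" for i j
    using idx[of i "n + j"] that assms(2-5) by auto
  then show "C = mat_adjoint E"
    using assms(3,4) by (intro eq_matI) auto
qed

definition unitary_mat :: "nat \<Rightarrow> complex mat \<Rightarrow> bool" where
  "unitary_mat n U \<longleftrightarrow> U \<in> carrier_mat n n \<and> mat_adjoint U * U = 1\<^sub>m n"

lemma unitary_mat_one: "unitary_mat n (1\<^sub>m n)"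
  by (simp add: unitary_mat_def)

lemma unitary_mat_carrier [dest]: "unitary_mat n U \<Longrightarrow> U \<in> carrier_mat n n"
  by (simp add: unitary_mat_def)

lemma unitary_mat_right:
  assumes "unitary_mat n U"
  shows "U * mat_adjoint U = 1\<^sub>m n"
  using assms mat_mult_left_right_inverse[of "mat_adjoint U" n U] by (auto simp: unitary_mat_def)

lemma unitary_mat_adjoint: "unitary_mat n U \<Longrightarrow> unitary_mat n (mat_adjoint U)"
  using unitary_mat_right by (auto simp: unitary_mat_def)

lemma unitary_mat_mult:
  assumes "unitary_mat n U" "unitary_mat n V"
  shows "unitary_mat n (U * V)"
proof -
  have U: "U \<in> carrier_mat n n" and V: "V \<in> carrier_mat n n"
    using assms by auto
  have "mat_adjoint (U * V) * (U * V) = mat_adjoint V * (mat_adjoint U * U) * V"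
    using U V by (simp add: mat_adjoint_mult[OF U V] assoc_mult_mat[of _ n n _ n _ n]
        mult_carrier_mat[of _ n n _ n])
  also have "\<dots> = 1\<^sub>m n"
    using assms V by (simp add: unitary_mat_def)
  finally show ?thesis
    using U V by (simp add: unitary_mat_def)
qed

lemma unitary_mat_four_block:
  assumes "unitary_mat n U" "unitary_mat m V"
  shows "unitary_mat (n + m) (four_block_mat U (0\<^sub>m n m) (0\<^sub>m m n) V)"
proof -
  have U: "U \<in> carrier_mat n n" and V: "V \<in> carrier_mat m m"
    using assms by auto
  show ?thesis
    using assms U V
    by (simp add: unitary_mat_def mat_adjoint_four_block_mat[OF U _ _ V]
        mult_four_block_mat[of _ n n _ m _ m _ _ n _ m])
qed

text \<open>
  Conjugation by a block diagonal matrix acts on each block separately. It serves twice: to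
  lift a diagonalization of the lower right block in the proof of the spectral theorem, and to
  diagonalize both diagonal blocks of a Hermitian matrix simultaneously.
\<close>

lemma four_block_diag_congruence:
  fixes B D :: "complex mat"
  assumes "B \<in> carrier_mat n n" "C \<in> carrier_mat n m" "E \<in> carrier_mat m n" "D \<in> carrier_mat m m"
    and "U \<in> carrier_mat n n" "V \<in> carrier_mat m m"
  shows "mat_adjoint (four_block_mat U (0\<^sub>m n m) (0\<^sub>m m n) V) * four_block_mat B C E D *
      four_block_mat U (0\<^sub>m n m) (0\<^sub>m m n) V =
    four_block_mat (mat_adjoint U * B * U) (mat_adjoint U * C * V)
      (mat_adjoint V * E * U) (mat_adjoint V * D * V)"
proof -
  note [simp] = mult_carrier_mat[of _ n n _ n] mult_carrier_mat[of _ m m _ m]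
    mult_carrier_mat[of _ n n _ m] mult_carrier_mat[of _ m m _ n]
    mult_carrier_mat[of _ n m _ m] mult_carrier_mat[of _ m n _ n]
    left_add_zero_mat[of _ n n] left_add_zero_mat[of _ n m]
    left_add_zero_mat[of _ m m] left_add_zero_mat[of _ m n]
    right_add_zero_mat[of _ n n] right_add_zero_mat[of _ n m]
    right_add_zero_mat[of _ m m] right_add_zero_mat[of _ m n]
  show ?thesis
    using assms
    by (simp add: mat_adjoint_four_block_mat[of _ n n _ m _ m]
        mult_four_block_mat[of _ n n _ m _ m _ _ n _ m])
qed

section \<open>Unitary diagonalization of Hermitian matrices\<close>

lemma exists_corthogonal_list:
  fixes v :: "complex vec"
  assumes v: "v \<in> carrier_vec n" and v0: "v \<noteq> 0\<^sub>v n"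
  shows "\<exists>ws. set ws \<subseteq> carrier_vec n \<and> length ws = n \<and> corthogonal ws \<and> ws ! 0 = v"
proof -
  interpret cof_vec_space n "TYPE(complex)" .
  define b where "b = basis_completion v"
  define ws where "ws = gram_schmidt n b"
  note bc = basis_completion[OF v v0, folded b_def]
  note gs = gram_schmidt_result[OF bc(2,4,5) refl, folded ws_def]
  have n: "n \<noteq> 0"
    using v v0 by auto
  obtain vs where "b = v # vs"
    using bc(6,7) n by (cases b) auto
  then have "hd ws = v"
    using v by (simp add: ws_def)
  then have "ws ! 0 = v"
    using gs(4) bc(6) n by (cases ws) auto
  then show ?thesis
    using gs bc(6) by metis
qed

text \<open>
  The Gram-Schmidt vectors are orthogonal but not of length one; dividing each by its length
  makes them the columns of a unitary matrix.
\<close>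

lemma exists_unitary_mat_first_col:
  fixes v :: "complex vec"
  assumes v: "v \<in> carrier_vec n" and v0: "v \<noteq> 0\<^sub>v n"
  shows "\<exists>W c. unitary_mat n W \<and> col W 0 = c \<cdot>\<^sub>v v"
proof -
  obtain ws where ws_carrier: "set ws \<subseteq> carrier_vec n" and len: "length ws = n"
    and orth: "corthogonal ws" and hd_ws: "ws ! 0 = v"
    using exists_corthogonal_list[OF v v0] by auto
  have n: "n \<noteq> 0"
    using v v0 by auto
  have ws: "ws ! i \<in> carrier_vec n" if "i < n" for i
    using ws_carrier that len by auto
  define c where "c = (\<lambda>w :: complex vec. complex_of_real (1 / sqrt (Re (w \<bullet>c w))))"
  define W where "W = mat_of_cols n (map (\<lambda>w. c w \<cdot>\<^sub>v w) ws)"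
  have W: "W \<in> carrier_mat n n"
    using mat_of_cols_carrier(1)[of n "map (\<lambda>w. c w \<cdot>\<^sub>v w) ws"] by (simp add: W_def len)
  have colW: "col W i = c (ws ! i) \<cdot>\<^sub>v ws ! i" if "i < n" for i
    using that ws[OF that] len by (simp add: W_def)
  have "(mat_adjoint W * W) $$ (i, j) = 1\<^sub>m n $$ (i, j)" if ij: "i < n" "j < n" for i j
  proof -
    have "(mat_adjoint W * W) $$ (i, j) = conjugate (col W i) \<bullet> col W j"
      using W ij by (simp add: mat_adjoint_def)
    also have "\<dots> = col W j \<bullet>c col W i"
      using W ij by (intro comm_scalar_prod[of _ n]) auto
    also have "\<dots> = c (ws ! j) * (ws ! j \<bullet>c ws ! i) * cnj (c (ws ! i))"
      using ws ij by (simp add: colW conjugate_smult_vec smult_scalar_prod_distrib[of _ n]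
          scalar_prod_smult_distrib[of _ n])
    also have "\<dots> = (if i = j then 1 else 0)"
    proof (cases "i = j")
      case True
      let ?w = "ws ! i"
      have "?w \<bullet>c ?w \<noteq> 0"
        using corthogonalD[OF orth, of i i] ij len by auto
      moreover have "?w \<bullet>c ?w \<ge> 0"
        by (rule conjugate_square_ge_0_vec)
      ultimately obtain r where r: "?w \<bullet>c ?w = complex_of_real r" "r > 0"
        by (auto simp: less_eq_complex_def complex_eq_iff intro: that[of "Re (?w \<bullet>c ?w)"])
      have "c ?w * complex_of_real r * cnj (c ?w)
          = complex_of_real (1 / sqrt r * r * (1 / sqrt r))"
        by (simp only: c_def r of_real_mult complex_cnj_complex_of_real Re_complex_of_real)
      also have "1 / sqrt r * r * (1 / sqrt r) = 1"
        using r(2) by (simp add: field_simps)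
      finally show ?thesis
        using True r by simp
    next
      case False
      then show ?thesis
        using corthogonalD[OF orth, of j i] ij len by simp
    qed
    finally show ?thesis
      using ij by simp
  qed
  then have "mat_adjoint W * W = 1\<^sub>m n"
    using W by (intro eq_matI) auto
  then show ?thesis
    using W colW[of 0] n hd_ws by (auto simp: unitary_mat_def)
qed

lemma exists_eigenvector:
  fixes A :: "complex mat"
  assumes A: "A \<in> carrier_mat n n" and n: "n \<noteq> 0"
  shows "\<exists>v e. v \<in> carrier_vec n \<and> v \<noteq> 0\<^sub>v n \<and> A *\<^sub>v v = e \<cdot>\<^sub>v v"
proof -
  obtain es where es: "char_poly A = (\<Prod>a \<leftarrow> es. [:- a, 1:])" "length es = n"
    using char_poly_factorized[OF A] by auto
  then obtain e es' where "es = e # es'"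
    using n by (cases es) auto
  then have "eigenvalue A e"
    using es by (simp add: eigenvalue_root_char_poly[OF A])
  then show ?thesis
    using A by (auto simp: eigenvalue_def eigenvector_def)
qed

text \<open>
  The spectral theorem. The entries of the diagonal matrix are real because conjugation
  preserves the property of being Hermitian.
\<close>

theorem hermitian_mat_diagonalization:
  assumes "A \<in> carrier_mat n n" "hermitian_mat A"
  shows "\<exists>U d. unitary_mat n U \<and>
    mat_adjoint U * A * U = mat_diag n (\<lambda>i. complex_of_real (d i))"
  using assms
proof (induction n arbitrary: A)
  case 0
  then show ?case
    by (intro exI[of _ "1\<^sub>m 0"] exI[of _ "\<lambda>_. 0"] conjI eq_matI) (auto simp: unitary_mat_def mat_diag_def)
next
  case (Suc n)
  note A = Suc.prems(1)
  obtain v e where v: "v \<in> carrier_vec (Suc n)" "v \<noteq> 0\<^sub>v (Suc n)" and ev: "A *\<^sub>v v = e \<cdot>\<^sub>v v"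
    using exists_eigenvector[OF A] by auto
  obtain W c where Wu: "unitary_mat (Suc n) W" and Wc: "col W 0 = c \<cdot>\<^sub>v v"
    using exists_unitary_mat_first_col[OF v] by auto
  have W: "W \<in> carrier_mat (Suc n) (Suc n)"
    using Wu by auto
  define A' where "A' = mat_adjoint W * A * W"
  have A': "A' \<in> carrier_mat (Suc n) (Suc n)"
    using A W by (auto simp: A'_def intro!: mult_carrier_mat)
  have hA': "hermitian_mat A'"
    unfolding A'_def by (rule hermitian_mat_congruence[OF A Suc.prems(2) W])
  have w0: "col W 0 \<in> carrier_vec (Suc n)"
    using carrier_matD[OF W] by (intro carrier_vecI) simp
  \<comment> \<open>As \<open>W\<close> maps the first unit vector to an eigenvector, that unit vector is an
    eigenvector of \<open>A'\<close>.\<close>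
  have "col A' 0 = mat_adjoint W *\<^sub>v (A *\<^sub>v col W 0)"
    unfolding A'_def assoc_mult_mat[OF mat_adjoint_carrier[OF W] A W]
    by (simp only: col_mult2[OF mat_adjoint_carrier[OF W] mult_carrier_mat[OF A W] zero_less_Suc]
        col_mult2[OF A W zero_less_Suc])
  also have "A *\<^sub>v col W 0 = e \<cdot>\<^sub>v col W 0"
    using A v ev by (simp add: Wc mult_mat_vec[of _ "Suc n" "Suc n"] smult_smult_assoc mult.commute)
  also have "mat_adjoint W *\<^sub>v (e \<cdot>\<^sub>v col W 0) = e \<cdot>\<^sub>v col (mat_adjoint W * W) 0"
    using W by (simp add: mult_mat_vec[OF _ w0, of _ "Suc n"] col_mult2[of _ "Suc n" "Suc n" _ "Suc n"])
  also have "\<dots> = e \<cdot>\<^sub>v unit_vec (Suc n) 0"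
    using Wu by (simp add: unitary_mat_def)
  finally have col0: "col A' 0 = e \<cdot>\<^sub>v unit_vec (Suc n) 0" .
  have A'0: "A' $$ (i, 0) = (if i = 0 then e else 0)" if "i < Suc n" for i
    using arg_cong[OF col0, of "\<lambda>w. w $ i"] A' that by simp
  obtain B C E D where split: "split_block A' 1 1 = (B, C, E, D)"
    by (metis prod_cases4)
  have dims: "dim_row A' = 1 + n" "dim_col A' = 1 + n"
    using A' by auto
  note sb = split_block[OF split dims]
  note hb = hermitian_four_block_matD[OF hA'[unfolded sb(5)] sb(1-4)]
  have E0: "E = 0\<^sub>m n 1"
  proof (rule eq_matI)
    fix i j assume "i < dim_row (0\<^sub>m n 1 :: complex mat)" "j < dim_col (0\<^sub>m n 1 :: complex mat)"
    then show "E $$ (i, j) = 0\<^sub>m n 1 $$ (i, j)"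
      using A'0[of "Suc i"] sb(1-4) by (simp add: sb(5))
  qed (use sb in auto)
  have C0: "C = 0\<^sub>m 1 n"
    unfolding hb(3) E0 by (rule eq_matI) auto
  have "e = cnj e"
    using A'0[of 0] hermitian_mat_index[OF hA', of 0 0] A' by simp
  then obtain r where r: "e = complex_of_real r"
    by (metis Reals_cnj_iff Reals_cases)
  have B: "B = mat_diag 1 (\<lambda>_. complex_of_real r)"
    using A'0[of 0] sb(1-4) by (intro eq_matI) (auto simp: sb(5) r mat_diag_def)
  obtain U d where Uu: "unitary_mat n U"
    and Ud: "mat_adjoint U * D * U = mat_diag n (\<lambda>i. complex_of_real (d i))"
    using Suc.IH[OF sb(4) hb(2)] by auto
  have U: "U \<in> carrier_mat n n"
    using Uu by auto
  define V where "V = four_block_mat (1\<^sub>m 1) (0\<^sub>m 1 n) (0\<^sub>m n 1) U"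
  have Vu: "unitary_mat (Suc n) V"
    using unitary_mat_four_block[OF unitary_mat_one[of 1] Uu] by (simp add: V_def)
  have V: "V \<in> carrier_mat (Suc n) (Suc n)"
    using Vu by auto
  have "mat_adjoint (W * V) * A * (W * V) = mat_adjoint V * A' * V"
    using A W V by (simp add: A'_def mat_adjoint_mult[OF W V]
        assoc_mult_mat[of _ "Suc n" "Suc n" _ "Suc n" _ "Suc n"]
        mult_carrier_mat[of _ "Suc n" "Suc n" _ "Suc n"])
  also have "\<dots> = four_block_mat B (0\<^sub>m 1 n) (0\<^sub>m n 1) (mat_adjoint U * D * U)"
    unfolding sb(5) V_def
    by (subst four_block_diag_congruence[OF sb(1-4) _ U]) (use sb U in \<open>auto simp: C0 E0\<close>)
  also have "\<dots> = mat_diag (Suc n) (\<lambda>i. complex_of_real (case_nat r d i))"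
    unfolding Ud B by (rule eq_matI) (auto simp: mat_diag_def split: nat.split)
  finally show ?case
    using unitary_mat_mult[OF Wu Vu] by blast
qed

lemma proots_prod_linear_factors:
  fixes as :: "'a :: idom list"
  shows "proots (\<Prod>a\<leftarrow>as. [:- a, 1:]) = mset as"
proof (induction as)
  case (Cons a as)
  have "(\<Prod>a\<leftarrow>as. [:- a, 1:]) \<noteq> 0"
    by auto
  then show ?case
    using Cons.IH by (simp add: proots_mult del: mult_pCons_left)
qed simp

text \<open>
  Any diagonalization, in whatever order it lists the eigenvalues, computes sums over the
  multiset of eigenvalues, since similar matrices have the same characteristic polynomial.
\<close>

lemma sum_real_eigenvalues:
  assumes A: "A \<in> carrier_mat n n" and U: "unitary_mat n U"
    and d: "mat_adjoint U * A * U = mat_diag n (\<lambda>i. complex_of_real (d i))"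
  shows "(\<Sum>x\<in>#real_eigenvalues A. f x) = (\<Sum>i<n. f (d i))"
proof -
  let ?D = "mat_diag n (\<lambda>i. complex_of_real (d i))"
  have "similar_mat_wit ?D A (mat_adjoint U) U"
    using A U unitary_mat_right[OF U]
    by (intro similar_mat_witI[of _ _ n]) (auto simp: unitary_mat_def d)
  then have "char_poly A = char_poly ?D"
    by (metis char_poly_similar similar_mat_def)
  also have "\<dots> = (\<Prod>a\<leftarrow>diag_mat ?D. [:- a, 1:])"
    by (rule char_poly_upper_triangular[of _ n]) (auto simp: mat_diag_def)
  also have "diag_mat ?D = map (\<lambda>i. complex_of_real (d i)) [0..<n]"
    by (auto simp: diag_mat_def mat_diag_def)
  finally have "proots (char_poly A) = mset (map (\<lambda>i. complex_of_real (d i)) [0..<n])"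
    by (simp only: proots_prod_linear_factors)
  then have "real_eigenvalues A = image_mset d (mset_set {0..<n})"
    by (simp add: real_eigenvalues_def image_mset.compositionality comp_def)
  then show ?thesis
    by (simp add: image_mset.compositionality comp_def sum_unfold_sum_mset lessThan_atLeast0)
qed

section \<open>Convex trace inequalities\<close>

text \<open>
  Since $X$ is unitary, the matrix $(|X_{ij}|^2)$ is doubly stochastic. Its column sums make every
  diagonal entry of $X^* D X$ a convex combination of the entries of $D$, so that Jensen's
  inequality applies; its row sums say that, over all diagonal entries together, each entry of $D$
  is used with total weight one.
\<close>

lemma sum_diagonal_le_of_convex:
  assumes X: "unitary_mat n X" and f: "convex_on UNIV f"
  shows "(\<Sum>j<n. f (Re ((mat_adjoint X * mat_diag n (\<lambda>i. complex_of_real (d i)) * X) $$ (j, j))))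
    \<le> (\<Sum>i<n. f (d i))"
proof -
  have Xc: "X \<in> carrier_mat n n"
    using X by auto
  define S where "S = (\<lambda>i j. (cmod (X $$ (i, j)))\<^sup>2)"
  have entry: "complex_of_real (S i j) = cnj (X $$ (i, j)) * X $$ (i, j)" for i j
    by (simp add: S_def complex_norm_square mult.commute flip: of_real_power)
  have cols: "(\<Sum>i<n. S i j) = 1" if "j < n" for j
  proof -
    have "complex_of_real (\<Sum>i<n. S i j) = (mat_adjoint X * X) $$ (j, j)"
      using Xc that by (simp add: entry scalar_prod_def lessThan_atLeast0)
    also have "\<dots> = complex_of_real 1"
      using X that by (simp add: unitary_mat_def)
    finally show ?thesis
      by (simp only: of_real_eq_iff)
  qed
  have rows: "(\<Sum>j<n. S i j) = 1" if "i < n" for i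
  proof -
    have "complex_of_real (\<Sum>j<n. S i j) = (X * mat_adjoint X) $$ (i, i)"
      using Xc that by (simp add: entry scalar_prod_def lessThan_atLeast0 mult.commute)
    also have "\<dots> = complex_of_real 1"
      using unitary_mat_right[OF X] that by simp
    finally show ?thesis
      by (simp only: of_real_eq_iff)
  qed
  have diag: "Re ((mat_adjoint X * mat_diag n (\<lambda>i. complex_of_real (d i)) * X) $$ (j, j))
      = (\<Sum>i<n. S i j * d i)" if "j < n" for j
  proof -
    have "(mat_adjoint X * mat_diag n (\<lambda>i. complex_of_real (d i)) * X) $$ (j, j)
        = (\<Sum>i<n. cnj (X $$ (i, j)) * complex_of_real (d i) * X $$ (i, j))"
      using Xc that
      by (simp add: mat_diag_mult_right[of _ n n] scalar_prod_def lessThan_atLeast0)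
    also have "\<dots> = complex_of_real (\<Sum>i<n. S i j * d i)"
      by (simp add: entry mult_ac)
    finally show ?thesis
      by simp
  qed
  have "(\<Sum>j<n. f (\<Sum>i<n. S i j * d i)) \<le> (\<Sum>j<n. \<Sum>i<n. S i j * f (d i))"
  proof (rule sum_mono)
    fix j assume j: "j \<in> {..<n}"
    have "f (\<Sum>i<n. S i j *\<^sub>R d i) \<le> (\<Sum>i<n. S i j * f (d i))"
      using j cols by (intro convex_on_sum[OF _ _ f]) (auto simp: S_def)
    then show "f (\<Sum>i<n. S i j * d i) \<le> (\<Sum>i<n. S i j * f (d i))"
      by simp
  qed
  also have "\<dots> = (\<Sum>i<n. (\<Sum>j<n. S i j) * f (d i))"
    by (subst sum.swap) (simp add: sum_distrib_right)
  also have "\<dots> = (\<Sum>i<n. f (d i))"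
    by (simp add: rows)
  finally show ?thesis
    by (simp add: diag)
qed

text \<open>
  Write $A$ for the block matrix. With $T$ the block diagonal matrix of two unitary matrices
  diagonalizing $B$ and $D$, the diagonal of $T^* A T$ consists of the eigenvalues of $B$
  followed by those of $D$, so that the averaging inequality above compares them with the
  eigenvalues of $A$.
\<close>

lemma sum_eigenvalues_two_blocks_le:
  assumes h: "hermitian_mat (four_block_mat B C E D)"
    and B: "B \<in> carrier_mat n n" and C: "C \<in> carrier_mat n m"
    and E: "E \<in> carrier_mat m n" and D: "D \<in> carrier_mat m m"
    and f: "convex_on UNIV f"
  shows "(\<Sum>x\<in>#real_eigenvalues B. f x) + (\<Sum>x\<in>#real_eigenvalues D. f x)
    \<le> (\<Sum>x\<in>#real_eigenvalues (four_block_mat B C E D). f x)"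
proof -
  let ?A = "four_block_mat B C E D"
  note hb = hermitian_four_block_matD[OF h B C E D]
  have A: "?A \<in> carrier_mat (n + m) (n + m)"
    using B D by simp
  obtain U b where U: "unitary_mat n U"
    and Ub: "mat_adjoint U * B * U = mat_diag n (\<lambda>i. complex_of_real (b i))"
    using hermitian_mat_diagonalization[OF B hb(1)] by auto
  obtain V c where V: "unitary_mat m V"
    and Vc: "mat_adjoint V * D * V = mat_diag m (\<lambda>i. complex_of_real (c i))"
    using hermitian_mat_diagonalization[OF D hb(2)] by auto
  obtain W a where W: "unitary_mat (n + m) W"
    and Wa: "mat_adjoint W * ?A * W = mat_diag (n + m) (\<lambda>i. complex_of_real (a i))"
    using hermitian_mat_diagonalization[OF A h] by auto
  define T where "T = four_block_mat U (0\<^sub>m n m) (0\<^sub>m m n) V"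
  have T: "unitary_mat (n + m) T"
    unfolding T_def by (rule unitary_mat_four_block[OF U V])
  define X where "X = mat_adjoint W * T"
  have X: "unitary_mat (n + m) X"
    unfolding X_def by (rule unitary_mat_mult[OF unitary_mat_adjoint[OF W] T])
  have Wc: "W \<in> carrier_mat (n + m) (n + m)" and Tc: "T \<in> carrier_mat (n + m) (n + m)"
    using W T by auto
  \<comment> \<open>The factors \<open>W * mat_adjoint W\<close> cancel, so this is conjugation of \<open>?A\<close> by \<open>T\<close>.\<close>
  have "mat_adjoint X * (mat_adjoint W * ?A * W) * X
      = mat_adjoint T * ((W * mat_adjoint W) * ?A * (W * mat_adjoint W)) * T"
    unfolding X_def mat_adjoint_mult[OF mat_adjoint_carrier[OF Wc] Tc]
    using Wc Tc A by (simp add: assoc_mult_mat[of _ "n + m" "n + m" _ "n + m" _ "n + m"]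
        mult_carrier_mat[of _ "n + m" "n + m" _ "n + m"])
  also have "\<dots> = mat_adjoint T * ?A * T"
    using A by (simp add: unitary_mat_right[OF W] left_mult_one_mat[OF A] right_mult_one_mat[OF A])
  also have "\<dots> = four_block_mat (mat_diag n (\<lambda>i. complex_of_real (b i))) (mat_adjoint U * C * V)
      (mat_adjoint V * E * U) (mat_diag m (\<lambda>i. complex_of_real (c i)))"
    unfolding T_def by (simp only: Ub Vc
        four_block_diag_congruence[OF B C E D unitary_mat_carrier[OF U] unitary_mat_carrier[OF V]])
  finally have M: "(mat_adjoint X * mat_diag (n + m) (\<lambda>i. complex_of_real (a i)) * X) $$ (j, j)
      = complex_of_real (if j < n then b j else c (j - n))" if "j < n + m" for j
    using that by (auto simp: Wa mat_diag_def)
  have "(\<Sum>j<n. f (b j)) + (\<Sum>j<m. f (c j))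
      = (\<Sum>j<n + m. f (if j < n then b j else c (j - n)))"
    by (induction m) (auto simp: ac_simps)
  also have "\<dots> \<le> (\<Sum>j<n + m. f (a j))"
    using sum_diagonal_le_of_convex[OF X f, of a] by (simp add: M)
  finally show ?thesis
    by (simp add: sum_real_eigenvalues[OF A W Wa] sum_real_eigenvalues[OF B U Ub]
        sum_real_eigenvalues[OF D V Vc])
qed

text \<open>
  Induction on the number of blocks: the last block is split off, and the remaining diagonal
  blocks are those of the leading principal submatrix.
\<close>

theorem sum_eigenvalues_diagonal_blocks_le:
  assumes "A \<in> carrier_mat (\<Sum>i<k. n i) (\<Sum>i<k. n i)" "hermitian_mat A" "convex_on UNIV f"
  shows "(\<Sum>i<k. \<Sum>x\<in>#real_eigenvalues (block_of n A i i). f x)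
    \<le> (\<Sum>x\<in>#real_eigenvalues A. f x)"
  using assms(1,2)
proof (induction k arbitrary: A)
  case 0
  then have "size (real_eigenvalues A) = 0"
    by (intro size_real_eigenvalues) auto
  then show ?case
    by simp
next
  case (Suc k)
  note A = Suc.prems(1)
  define N where "N = (\<Sum>i<k. n i)"
  obtain B C E D where split: "split_block A N N = (B, C, E, D)"
    by (metis prod_cases4)
  have dims: "dim_row A = N + n k" "dim_col A = N + n k"
    using A by (auto simp: N_def)
  note sb = split_block[OF split dims]
  note hb = hermitian_four_block_matD[OF Suc.prems(2)[unfolded sb(5)] sb(1-4)]
  have B: "B \<in> carrier_mat (\<Sum>i<k. n i) (\<Sum>i<k. n i)"
    using sb(1) by (simp add: N_def)
  have blocks: "block_of n A i i = block_of n B i i" if i: "i < k" for i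
  proof (rule eq_matI)
    note cA = block_of_carrier[OF A, of i i] and cB = block_of_carrier[OF B i i]
    show "dim_row (block_of n A i i) = dim_row (block_of n B i i)"
      "dim_col (block_of n A i i) = dim_col (block_of n B i i)"
      using cA cB i by auto
    fix r c assume "r < dim_row (block_of n B i i)" "c < dim_col (block_of n B i i)"
    then have rc: "r < n i" "c < n i"
      using cB by auto
    have "(\<Sum>l<Suc i. n l) \<le> N"
      unfolding N_def using i by (intro sum_mono2) auto
    then have "(\<Sum>l<i. n l) + r < N" "(\<Sum>l<i. n l) + c < N"
      using rc by auto
    moreover have "A $$ (a, b) = B $$ (a, b)" if "a < N" "b < N" for a b
      using that sb(1-4) by (simp add: sb(5))
    ultimately show "block_of n A i i $$ (r, c) = block_of n B i i $$ (r, c)"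
      using i rc by (simp add: block_of_index[OF A] block_of_index[OF B])
  qed
  have last: "block_of n A k k = D"
  proof (rule eq_matI)
    note cA = block_of_carrier[OF A, of k k]
    show "dim_row (block_of n A k k) = dim_row D" "dim_col (block_of n A k k) = dim_col D"
      using cA sb(4) by auto
    fix r c assume "r < dim_row D" "c < dim_col D"
    then have rc: "r < n k" "c < n k"
      using sb(4) by auto
    have "A $$ (N + r, N + c) = D $$ (r, c)"
      using rc sb(1-4) by (simp add: sb(5))
    then show "block_of n A k k $$ (r, c) = D $$ (r, c)"
      using rc by (simp add: block_of_index[OF A] flip: N_def)
  qed
  have "(\<Sum>i<Suc k. \<Sum>x\<in>#real_eigenvalues (block_of n A i i). f x)
      = (\<Sum>i<k. \<Sum>x\<in>#real_eigenvalues (block_of n B i i). f x) + (\<Sum>x\<in>#real_eigenvalues D. f x)"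
    by (simp add: blocks last)
  also have "\<dots> \<le> (\<Sum>x\<in>#real_eigenvalues B. f x) + (\<Sum>x\<in>#real_eigenvalues D. f x)"
    using Suc.IH[OF B hb(1)] by simp
  also have "\<dots> \<le> (\<Sum>x\<in>#real_eigenvalues A. f x)"
    unfolding sb(5)
    by (rule sum_eigenvalues_two_blocks_le[OF Suc.prems(2)[unfolded sb(5)] sb(1-4) assms(3)])
  finally show ?case .
qed

section \<open>Energies of block matrices\<close>

text \<open>
  The power function is convex on the positive reals. Zero has to be included by hand, where
  convexity amounts to $s^p \le s$ for $0 < s < 1$. Precomposition with the convex function
  $x \mapsto \max(x,0)$ then preserves convexity because the power function is nondecreasing
  on the nonnegative reals.
\<close>

lemma convex_on_max_0_powr:
  fixes p :: real
  assumes "p \<ge> 1"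
  shows "convex_on UNIV (\<lambda>x. max x 0 powr p)"
proof (rule convex_onI)
  fix t x y :: real
  assume t: "0 < t" "t < 1"
  let ?u = "max x 0" and ?v = "max y 0"
  have scale: "(s * z) powr p \<le> s * z powr p" if "0 < s" "s < 1" "z \<ge> 0" for s z :: real
    using that powr_mono'[of 1 p s] assms
    by (simp add: powr_mult mult_right_mono)
  \<comment> \<open>Convexity of the power function on the closed half line, with the endpoint treated apart.\<close>
  have cvx: "((1 - t) * u + t * v) powr p \<le> (1 - t) * u powr p + t * v powr p"
    if uv: "u \<ge> 0" "v \<ge> 0" for u v :: real
  proof -
    consider "u = 0" | "v = 0" | "u > 0" "v > 0"
      using uv by fastforce
    then show ?thesis
    proof cases
      case 1
      then show ?thesis
        using scale[of t v] t uv by simp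
    next
      case 2
      then show ?thesis
        using scale[of "1 - t" u] t uv by simp
    next
      case 3
      then show ?thesis
        using convex_onD[OF powr_convex[OF assms], of t u v] t by simp
    qed
  qed
  have "max ((1 - t) * x + t * y) 0 \<le> (1 - t) * ?u + t * ?v"
    using t by (auto intro!: add_mono mult_left_mono)
  then have "max ((1 - t) * x + t * y) 0 powr p \<le> ((1 - t) * ?u + t * ?v) powr p"
    using assms by (intro powr_mono2) auto
  also have "\<dots> \<le> (1 - t) * ?u powr p + t * ?v powr p"
    by (rule cvx) auto
  finally show "max ((1 - t) *\<^sub>R x + t *\<^sub>R y) 0 powr p \<le> (1 - t) * ?u powr p + t * ?v powr p"
    by simp
qed simp

lemma pos_energy_eq: "pos_energy p M = (\<Sum>x\<in>#real_eigenvalues M. max x 0 powr p)"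
proof -
  have "(\<Sum>x\<in>#filter_mset (\<lambda>x. x > 0) R. x powr p) = (\<Sum>x\<in>#R. max x 0 powr p)" for R :: "real multiset"
    by (induction R) auto
  then show ?thesis
    by (simp add: pos_energy_def)
qed

lemma neg_energy_eq: "neg_energy p M = (\<Sum>x\<in>#real_eigenvalues M. max (- x) 0 powr p)"
proof -
  have "(\<Sum>x\<in>#filter_mset (\<lambda>x. x < 0) R. \<bar>x\<bar> powr p) = (\<Sum>x\<in>#R. max (- x) 0 powr p)"
    for R :: "real multiset"
    by (induction R) auto
  then show ?thesis
    by (simp add: neg_energy_def)
qed

theorem theorem3:
  fixes A :: "complex mat" and k :: nat and n :: "nat \<Rightarrow> nat" and p :: real
  assumes "A \<in> carrier_mat (\<Sum>i<k. n i) (\<Sum>i<k. n i)"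
    and "hermitian_mat A"
    and "p \<ge> 1"
  shows "pos_energy p A \<ge> (\<Sum>i<k. pos_energy p (block_of n A i i)) \<and>
         neg_energy p A \<ge> (\<Sum>i<k. neg_energy p (block_of n A i i))"
proof
  show "pos_energy p A \<ge> (\<Sum>i<k. pos_energy p (block_of n A i i))"
    unfolding pos_energy_eq
    by (rule sum_eigenvalues_diagonal_blocks_le[OF assms(1,2) convex_on_max_0_powr[OF assms(3)]])
  have "convex_on UNIV (\<lambda>x. max (- x) 0 powr p)"
  proof (rule convex_onI)
    fix t x y :: real
    assume "0 < t" "t < 1"
    then show "max (- ((1 - t) *\<^sub>R x + t *\<^sub>R y)) 0 powr p
        \<le> (1 - t) * max (- x) 0 powr p + t * max (- y) 0 powr p"
      using convex_onD[OF convex_on_max_0_powr[OF assms(3)], of t "- x" "- y"]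
      by (simp add: algebra_simps)
  qed simp
  then show "neg_energy p A \<ge> (\<Sum>i<k. neg_energy p (block_of n A i i))"
    unfolding neg_energy_eq
    by (rule sum_eigenvalues_diagonal_blocks_le[OF assms(1,2)])
qed

end
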